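(* Let $V$ be a non-trivial Euclidean space of finite dimension, and let $\delta,\epsilon$ be rotations in $V$ with angles $\alpha,\beta\in\,]0,\pi[$ respectively. Let $V^{\mathbb{C}}=\mathbb{C}\otimes_{\mathbb{R}}V$, let $\delta_{\mathbb{C}},\epsilon_{\mathbb{C}}$ be the $\mathbb{C}$-linear extensions of $\delta,\epsilon$ to $V^{\mathbb{C}}$, and set $$A=\ker(\delta_{\mathbb{C}}-e^{i\alpha}\mathbb{I}),\quad B=\ker(\delta_{\mathbb{C}}-e^{-i\alpha}\mathbb{I}),\quad C=\ker(\epsilon_{\mathbb{C}}-e^{i\beta}\mathbb{I}),\quad D=\ker(\epsilon_{\mathbb{C}}-e^{-i\beta}\mathbb{I}),$$ where $\mathbb{I}$ is the identity map of $V^{\mathbb{C}}$. Then there exists a $2$-dimensional subspace of $V$ which is invariant under $\delta$ and $\epsilon$ if and only if one of the following conditions is satisfied: \begin{enumerate} \item At least one of the intersections $A\cap C$ and $A\cap D$ is non-trivial (non-zero). \item Both $A\cap C$ and $A\cap D$ are zero, and the antilinear operator $T=\kappa\circ P_B|_C\circ (P_A|_C)^{-1}:A\to A$ has a $1$-dimensional invariant (complex) subspace. \end{enumerate}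
   Context: A rotation in a Euclidean space $V=(V,\langle\,,\rangle)$ is an orthogonal endomorphism $\delta\in O(V)$ such that (1) $\delta^2(v)\in\operatorname{span}\{v,\delta(v)\}$ and (2) $\langle v,\delta(v)\rangle=\langle w,\delta(w)\rangle$ for all unit vectors $v,w\in V$. Its angle is $a(\delta)=\arccos\langle v,\delta(v)\rangle\in[0,\pi]$, for any unit vector $v$. $V^{\mathbb{C}}$ carries the induced Hermitian inner product $\langle\lambda\otimes u,\mu\otimes v\rangle=\lambda\bar\mu\langle u,v\rangle$, and $V$ is identified with $\mathbb{R}\otimes V\subset V^{\mathbb{C}}$, so that $V^{\mathbb{C}}=V\oplus iV$ as a real vector space. The conjugation map $\kappa:V^{\mathbb{C}}\to V^{\mathbb{C}}$, $v_1+v_2\mapsto v_1-v_2$ for $v_1\in V$, $v_2\in iV$, is antilinear (additive with $\kappa(\lambda v)=\bar\lambda\kappa(v)$ for $\lambda\in\mathbb{C}$). One has orthogonal decompositions $V^{\mathbb{C}}=A\oplus B=C\oplus D$, and $\kappa(A)=B$, $\kappa(C)=D$. $P_A:V^{\mathbb{C}}\to A$ and $P_B:V^{\mathbb{C}}\to B$ are the orthogonal projections. When $A\cap C=A\cap D=0$, the restrictions $P_A|_C:C\to A$ and $P_B|_C:C\to B$ are bijective, so $T$ is defined as the composition $A\xrightarrow{(P_A|_C)^{-1}}C\xrightarrow{P_B|_C}B\xrightarrow{\kappa}A$. *)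

theory Defs
  imports "HOL-Analysis.Analysis"
begin

definition rotation :: "('a::euclidean_space \<Rightarrow> 'a) \<Rightarrow> bool" where
  "rotation \<delta> \<longleftrightarrow> orthogonal_transformation \<delta>
     \<and> (\<forall>v. \<delta> (\<delta> v) \<in> span {v, \<delta> v})
     \<and> (\<forall>v w. norm v = 1 \<longrightarrow> norm w = 1 \<longrightarrow> v \<bullet> \<delta> v = w \<bullet> \<delta> w)"

definition rotation_angle :: "('a::euclidean_space \<Rightarrow> 'a) \<Rightarrow> real" where
  "rotation_angle \<delta> = (THE a. \<forall>v. norm v = 1 \<longrightarrow> a = arccos (v \<bullet> \<delta> v))"

lemma rotation_angle_eq:
  assumes "rotation \<delta>" "norm v = 1"
  shows "rotation_angle \<delta> = arccos (v \<bullet> \<delta> v)"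
  unfolding rotation_angle_def
proof (rule the_equality)
  show "\<forall>w. norm w = 1 \<longrightarrow> arccos (v \<bullet> \<delta> v) = arccos (w \<bullet> \<delta> w)"
    using assms unfolding rotation_def by metis
qed (use assms(2) in blast)

text \<open>The complexification of a real space is modelled on pairs: \<open>(x, y)\<close> stands for
  \<open>x + i y\<close>, that is \<open>1 \<otimes> x + i \<otimes> y\<close>. The type already carries the
  addition and the real scalar multiplication; the complex one is \<open>cscale\<close>.\<close>

type_synonym 'a cplx = "'a \<times> 'a"

definition cscale :: "complex \<Rightarrow> 'a::real_vector cplx \<Rightarrow> 'a cplx" where
  "cscale z v = (Re z *\<^sub>R fst v - Im z *\<^sub>R snd v, Re z *\<^sub>R snd v + Im z *\<^sub>R fst v)"

global_interpretation cvs: vector_space "cscale :: complex \<Rightarrow> 'a::real_vector cplx \<Rightarrow> 'a cplx"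
  by unfold_locales
     (simp_all add: cscale_def prod_eq_iff scaleR_add_left scaleR_add_right
        scaleR_diff_left scaleR_diff_right)

definition ctensor :: "complex \<Rightarrow> 'a::real_vector \<Rightarrow> 'a cplx" where
  "ctensor z x = (Re z *\<^sub>R x, Im z *\<^sub>R x)"

lemma ctensor_cscale: "ctensor z x = cscale z (x, 0)"
  by (simp add: ctensor_def cscale_def)

lemma cplx_eq_ctensor: "v = ctensor 1 (fst v) + ctensor \<i> (snd v)"
  by (simp add: ctensor_def prod_eq_iff)

text \<open>Linear in the first argument, antilinear in the second.\<close>

definition hinner :: "'a::real_inner cplx \<Rightarrow> 'a cplx \<Rightarrow> complex" where
  "hinner v w = Complex (fst v \<bullet> fst w + snd v \<bullet> snd w) (snd v \<bullet> fst w - fst v \<bullet> snd w)"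

lemma hinner_ctensor: "hinner (ctensor z u) (ctensor w v) = z * cnj w * complex_of_real (u \<bullet> v)"
  by (simp add: hinner_def ctensor_def complex_eq_iff algebra_simps)

lemma hinner_add_left: "hinner (u + v) w = hinner u w + hinner v w"
  by (simp add: hinner_def complex_eq_iff inner_add_left)

lemma hinner_cscale_left: "hinner (cscale z v) w = z * hinner v w"
  by (simp add: hinner_def cscale_def complex_eq_iff inner_diff_left inner_add_left algebra_simps)

lemma hinner_commute: "hinner v w = cnj (hinner w v)"
  by (simp add: hinner_def complex_eq_iff inner_commute)

lemma hinner_self: "hinner v v = complex_of_real ((norm v)\<^sup>2)"
  by (simp add: hinner_def complex_eq_iff inner_commute power2_norm_eq_inner inner_prod_def)

definition cconj :: "'a::real_vector cplx \<Rightarrow> 'a cplx" where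
  "cconj v = (fst v, - snd v)"

lemma cconj_cscale: "cconj (cscale z v) = cscale (cnj z) (cconj v)"
  by (simp add: cconj_def cscale_def)

definition cext :: "('a::real_vector \<Rightarrow> 'a) \<Rightarrow> 'a cplx \<Rightarrow> 'a cplx" where
  "cext f v = (f (fst v), f (snd v))"

lemma cext_linear:
  assumes "linear f"
  shows "Vector_Spaces.linear cscale cscale (cext f)"
  by unfold_locales
     (simp_all add: cext_def cscale_def prod_eq_iff linear_add[OF assms] linear_diff[OF assms]
        linear_scale[OF assms])

lemma cext_unique:
  assumes "Vector_Spaces.linear cscale cscale g" "\<And>x. g (ctensor 1 x) = ctensor 1 (f x)"
  shows "g = cext f"
proof
  fix v
  interpret g: Vector_Spaces.linear cscale cscale g by fact
  have i: "ctensor \<i> x = cscale \<i> (ctensor 1 x)" for x :: 'a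
    by (simp add: ctensor_def cscale_def)
  have "g v = g (ctensor 1 (fst v)) + g (cscale \<i> (ctensor 1 (snd v)))"
    using cplx_eq_ctensor[of v] by (metis g.add i)
  also have "\<dots> = cext f v"
    by (simp add: g.scale assms(2)) (simp add: ctensor_def cscale_def cext_def)
  finally show "g v = cext f v" .
qed

definition eigenspace :: "('a::real_vector cplx \<Rightarrow> 'a cplx) \<Rightarrow> complex \<Rightarrow> 'a cplx set" where
  "eigenspace F z = {v. F v - cscale z v = 0}"

definition hproj :: "'a::real_inner cplx set \<Rightarrow> 'a cplx \<Rightarrow> 'a cplx" where
  "hproj S v = (THE p. p \<in> S \<and> (\<forall>s\<in>S. hinner (v - p) s = 0))"

text \<open>\<open>inv_into C (hproj A)\<close> is the inverse of \<open>P_A\<close> restricted to \<open>C\<close>; the operator is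
  meaningful only on \<open>A\<close>, and only when that restriction is a bijection onto \<open>A\<close>.\<close>

definition T_op :: "'a::real_inner cplx set \<Rightarrow> 'a cplx set \<Rightarrow> 'a cplx set \<Rightarrow> 'a cplx \<Rightarrow> 'a cplx" where
  "T_op A B C = cconj \<circ> hproj B \<circ> inv_into C (hproj A)"

end

theory Submission
  imports Defs
begin

text \<open>A rotation of angle \<open>\<alpha>\<close> is \<open>cos \<alpha> + sin \<alpha> J\<close> for an orthogonal complex structure \<open>J\<close>, and
  similarly \<open>\<epsilon>\<close> yields \<open>K\<close>; in the pair model \<open>A\<close> and \<open>C\<close> are the graphs of \<open>-J\<close> and \<open>-K\<close>,
  and \<open>B\<close> and \<open>D\<close> those of \<open>J\<close> and \<open>K\<close>. The invariant planes of \<open>\<delta>\<close> and \<open>\<epsilon>\<close> are those of \<open>J\<close>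
  and \<open>K\<close>. For \<open>v\<close> in such a plane the vectors \<open>v\<close>, \<open>J v + K v\<close>, \<open>J v - K v\<close> are pairwise orthogonal,
  so one of the last two vanishes if \<open>v \<noteq> 0\<close>, which already gives the first condition.
  Conversely, \<open>J v = K v\<close> or \<open>J v = - K v\<close> makes \<open>span {v, J v}\<close> invariant, and if
  \<open>T\<close> maps \<open>p - i J p\<close> to a complex multiple \<open>q - i J q\<close>, where
  \<open>p = (x - J K x) / 2\<close> and \<open>q = (x + J K x) / 2\<close>, then \<open>span {p, J p}\<close> contains \<open>x\<close> and \<open>K x\<close>.\<close>

section \<open>Orthogonal complex structures\<close>

definition ortho_complex :: "('a::euclidean_space \<Rightarrow> 'a) \<Rightarrow> bool" where
  "ortho_complex J \<longleftrightarrow> orthogonal_transformation J \<and> (\<forall>v. J (J v) = - v)"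

text \<open>In the pair model \<open>(x, - J x)\<close> is x - i J x, which the complexified
  \<open>J\<close> multiplies by i when \<open>J\<close> is a complex structure.\<close>

definition skew_graph :: "('a::euclidean_space \<Rightarrow> 'a) \<Rightarrow> 'a cplx set" where
  "skew_graph J = range (\<lambda>x. (x, - J x))"

lemma ortho_complex_linear: "ortho_complex J \<Longrightarrow> linear J"
  by (simp add: ortho_complex_def orthogonal_transformation_def)

lemma ortho_complex_square: "ortho_complex J \<Longrightarrow> J (J v) = - v"
  by (simp add: ortho_complex_def)

lemma ortho_complex_inner: "ortho_complex J \<Longrightarrow> J v \<bullet> J w = v \<bullet> w"
  by (simp add: ortho_complex_def orthogonal_transformation_def)

text \<open>The transpose of an orthogonal map is its inverse, here \<open>- J\<close>.\<close>

lemma ortho_complex_skew: "ortho_complex J \<Longrightarrow> v \<bullet> J w = - (J v \<bullet> w)"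
  by (metis ortho_complex_inner ortho_complex_square inner_minus_right)

lemma ortho_complex_self: "ortho_complex J \<Longrightarrow> v \<bullet> J v = 0"
  using ortho_complex_skew[of J v v] by (simp add: inner_commute)

text \<open>Lets facts about \<open>J\<close> be reused for the conjugate eigenspace.\<close>

lemma ortho_complex_uminus: "ortho_complex J \<Longrightarrow> ortho_complex (\<lambda>v. - J v)"
  by (simp add: ortho_complex_def orthogonal_transformation_def linear_compose_neg linear_neg)

section \<open>From rotations to complex structures\<close>

lemma rotation_inner:
  assumes "rotation \<delta>" "\<alpha> = rotation_angle \<delta>"
  shows "v \<bullet> \<delta> v = cos \<alpha> * (v \<bullet> v)"
proof (cases "v = 0")
  case False
  define u where "u = (1 / norm v) *\<^sub>R v"
  have ot: "orthogonal_transformation \<delta>" and lin: "linear \<delta>"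
    using assms(1) by (auto simp: rotation_def orthogonal_transformation_def)
  have u: "norm u = 1" "v = norm v *\<^sub>R u"
    using False by (auto simp: u_def)
  have "norm (\<delta> u) = 1"
    using ot u(1) by (simp add: orthogonal_transformation_norm)
  \<comment> \<open>\<open>cos\<close> undoes \<open>arccos\<close> only on [-1, 1]; Cauchy-Schwarz
    puts the argument there.\<close>
  then have "\<bar>u \<bullet> \<delta> u\<bar> \<le> 1"
    using Cauchy_Schwarz_ineq2[of u "\<delta> u"] u(1) by simp
  then have "cos \<alpha> = u \<bullet> \<delta> u"
    using rotation_angle_eq[OF assms(1) u(1)] assms(2) by (simp add: cos_arccos_abs)
  moreover have "v \<bullet> \<delta> v = (norm v)\<^sup>2 * (u \<bullet> \<delta> u)"
    by (metis u(2) lin linear_scale inner_scaleR_left inner_scaleR_right mult.assoc power2_eq_square)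
  ultimately show ?thesis
    by (simp add: power2_norm_eq_inner)
qed (use assms in \<open>simp add: rotation_def\<close>)

text \<open>Polarising \<open>\<langle>v, \<delta> v\<rangle> = cos \<alpha> \<langle>v, v\<rangle>\<close> gives \<open>\<delta> + \<delta>\<^sup>T = 2 cos \<alpha>\<close>; now compose with \<open>\<delta>\<close>.\<close>

lemma rotation_square:
  assumes "rotation \<delta>" "\<alpha> = rotation_angle \<delta>"
  shows "\<delta> (\<delta> v) = (2 * cos \<alpha>) *\<^sub>R \<delta> v - v"
proof -
  have lin: "linear \<delta>" and iso: "\<delta> x \<bullet> \<delta> y = x \<bullet> y" for x y
    using assms(1) by (auto simp: rotation_def orthogonal_transformation_def)
  have polar: "x \<bullet> \<delta> y + y \<bullet> \<delta> x = 2 * cos \<alpha> * (x \<bullet> y)" for x y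
    using rotation_inner[OF assms, of "x + y"] rotation_inner[OF assms, of x]
      rotation_inner[OF assms, of y]
    by (simp add: linear_add[OF lin] inner_add_left inner_add_right inner_commute[of y x]
        algebra_simps)
  have "(\<delta> (\<delta> v) - ((2 * cos \<alpha>) *\<^sub>R \<delta> v - v)) \<bullet> w = 0" for w
    using polar[of w "\<delta> v"] iso[of v w]
    by (simp add: inner_diff_left inner_diff_right inner_commute)
  then have "\<delta> (\<delta> v) - ((2 * cos \<alpha>) *\<^sub>R \<delta> v - v) = 0"
    by (metis inner_eq_zero_iff)
  then show ?thesis by simp
qed

text \<open>Completing the square in \<open>rotation_square\<close> gives (\<delta> - cos
  \<alpha>)^2 = - sin^2 \<alpha>, so \<delta> - cos \<alpha> divided by sin \<alpha> is a square
  root of -1.\<close>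

lemma rotation_decompose:
  assumes "rotation \<delta>" "\<alpha> = rotation_angle \<delta>" "0 < \<alpha>" "\<alpha> < pi"
  obtains J where "ortho_complex J" "\<And>v. \<delta> v = cos \<alpha> *\<^sub>R v + sin \<alpha> *\<^sub>R J v"
proof
  define J where "J = (\<lambda>v. (1 / sin \<alpha>) *\<^sub>R (\<delta> v - cos \<alpha> *\<^sub>R v))"
  have s: "sin \<alpha> \<noteq> 0"
    using sin_gt_zero[OF assms(3,4)] by simp
  have lin: "linear \<delta>" and iso: "\<delta> x \<bullet> \<delta> y = x \<bullet> y" for x y
    using assms(1) by (auto simp: rotation_def orthogonal_transformation_def)
  show dec: "\<delta> v = cos \<alpha> *\<^sub>R v + sin \<alpha> *\<^sub>R J v" for v
    using s by (simp add: J_def)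
  have linJ: "linear J"
    unfolding J_def
    by (intro linear_compose_scale_right linear_compose_sub lin linear_id[unfolded id_def])
  have sq: "J (J v) = - v" for v
  proof -
    have "sin \<alpha> *\<^sub>R (sin \<alpha> *\<^sub>R J (J v)) = \<delta> (\<delta> v - cos \<alpha> *\<^sub>R v) - cos \<alpha> *\<^sub>R (\<delta> v - cos \<alpha> *\<^sub>R v)"
      using s by (simp add: J_def linear_scale[OF lin] linear_diff[OF lin] scaleR_diff_right)
    also have "\<dots> = - ((1 - (cos \<alpha>)\<^sup>2) *\<^sub>R v)"
      by (simp add: linear_scale[OF lin] linear_diff[OF lin] rotation_square[OF assms(1,2)]
          algebra_simps scaleR_2 power2_eq_square flip: scaleR_scaleR)
    also have "1 - (cos \<alpha>)\<^sup>2 = sin \<alpha> * sin \<alpha>"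
      using sin_squared_eq[of \<alpha>] by (simp add: power2_eq_square)
    finally have "sin \<alpha> *\<^sub>R (sin \<alpha> *\<^sub>R J (J v)) = sin \<alpha> *\<^sub>R (sin \<alpha> *\<^sub>R (- v))"
      by simp
    then show ?thesis
      using s by (simp only: scaleR_cancel_left) simp
  qed
  \<comment> \<open>The cosine term is the whole component of \<open>\<delta> v\<close> along
    \<open>v\<close>, so \<open>J v\<close> is orthogonal to \<open>v\<close>; Pythagoras and the
    isometry \<delta> then fix the length of \<open>J v\<close>.\<close>
  have "J v \<bullet> J v = v \<bullet> v" for v
  proof -
    have "v \<bullet> \<delta> v = cos \<alpha> * (v \<bullet> v) + sin \<alpha> * (v \<bullet> J v)"
      by (simp add: dec inner_add_right)
    then have orth: "v \<bullet> J v = 0"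
      using s rotation_inner[OF assms(1,2), of v] by simp
    have "v \<bullet> v = (cos \<alpha> * cos \<alpha>) * (v \<bullet> v) + (sin \<alpha> * sin \<alpha>) * (J v \<bullet> J v)"
      using iso[of v v] orth
      by (simp add: dec inner_add_left inner_add_right inner_commute[of "J v" v])
    then have "(sin \<alpha> * sin \<alpha>) * (J v \<bullet> J v) = (1 - (cos \<alpha>)\<^sup>2) * (v \<bullet> v)"
      by (simp add: algebra_simps power2_eq_square)
    also have "1 - (cos \<alpha>)\<^sup>2 = sin \<alpha> * sin \<alpha>"
      using sin_squared_eq[of \<alpha>] by (simp add: power2_eq_square)
    finally show ?thesis
      using s by simp
  qed
  then have "orthogonal_transformation J"
    using linJ by (simp add: orthogonal_transformation norm_eq_sqrt_inner)
  with sq show "ortho_complex J"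
    by (simp add: ortho_complex_def)
qed

section \<open>Eigenspaces as graphs\<close>

lemma eigenspace_skew_graph:
  assumes "ortho_complex J" and dec: "\<And>v. \<delta> v = a *\<^sub>R v + b *\<^sub>R J v" and "b \<noteq> 0"
  shows "eigenspace (cext \<delta>) (Complex a b) = skew_graph J"
proof -
  have "(x, y) \<in> eigenspace (cext \<delta>) (Complex a b) \<longleftrightarrow> y = - J x" for x y
  proof -
    \<comment> \<open>The operator is b (J - i); these are its real and imaginary parts, and
      applying \<open>J\<close> to the first equation yields the second.\<close>
    have "(x, y) \<in> eigenspace (cext \<delta>) (Complex a b) \<longleftrightarrow> b *\<^sub>R (J x + y) = 0 \<and> b *\<^sub>R (J y - x) = 0"
      by (simp add: eigenspace_def cext_def cscale_def dec prod_eq_iff algebra_simps)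
    also have "\<dots> \<longleftrightarrow> y = - J x"
      using \<open>b \<noteq> 0\<close>
      by (auto simp: add_eq_0_iff linear_neg[OF ortho_complex_linear[OF assms(1)]]
          ortho_complex_square[OF assms(1)])
    finally show ?thesis .
  qed
  then show ?thesis
    by (auto simp: skew_graph_def)
qed

lemma rotation_eigenspaces:
  assumes "ortho_complex J" and dec: "\<And>v. \<delta> v = cos \<alpha> *\<^sub>R v + sin \<alpha> *\<^sub>R J v" and "sin \<alpha> \<noteq> 0"
  shows "eigenspace (cext \<delta>) (exp (\<i> * complex_of_real \<alpha>)) = skew_graph J"
    and "eigenspace (cext \<delta>) (exp (- \<i> * complex_of_real \<alpha>)) = skew_graph (\<lambda>v. - J v)"
proof -
  have "exp (\<i> * complex_of_real \<alpha>) = Complex (cos \<alpha>) (sin \<alpha>)"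
    by (simp add: complex_eq_iff Re_exp Im_exp)
  then show "eigenspace (cext \<delta>) (exp (\<i> * complex_of_real \<alpha>)) = skew_graph J"
    using eigenspace_skew_graph[of J \<delta>] assms by simp
  \<comment> \<open>The conjugate eigenvalue corresponds to writing \<delta> = cos \<alpha> + (- sin
    \<alpha>) (- J).\<close>
  have "exp (- \<i> * complex_of_real \<alpha>) = Complex (cos \<alpha>) (- sin \<alpha>)"
    by (simp add: complex_eq_iff Re_exp Im_exp)
  then show "eigenspace (cext \<delta>) (exp (- \<i> * complex_of_real \<alpha>)) = skew_graph (\<lambda>v. - J v)"
    using eigenspace_skew_graph[OF ortho_complex_uminus[OF assms(1)], of \<delta> "cos \<alpha>" "- sin \<alpha>"] assms
    by simp
qed

lemma skew_graph_Int_nontrivial: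
  assumes "linear J" "linear K"
  shows "skew_graph J \<inter> skew_graph K \<noteq> {0} \<longleftrightarrow> (\<exists>x. x \<noteq> 0 \<and> J x = K x)"
proof -
  have "skew_graph J \<inter> skew_graph K = (\<lambda>x. (x, - J x)) ` {x. J x = K x}"
    by (auto simp: skew_graph_def)
  \<comment> \<open>An empty intersection would also differ from \<open>{0}\<close>, so zero is
    exhibited.\<close>
  moreover have "(0, 0) \<in> (\<lambda>x. (x, - J x)) ` {x. J x = K x}"
    using assms by (auto simp: linear_0 image_iff)
  ultimately show ?thesis
    using assms by (auto simp: zero_prod_def) metis
qed

section \<open>Orthogonal projections onto graphs\<close>

lemma hproj_eqI:
  assumes "p \<in> S" "\<And>s. s \<in> S \<Longrightarrow> hinner (v - p) s = 0"
    and diff: "\<And>s t. s \<in> S \<Longrightarrow> t \<in> S \<Longrightarrow> s - t \<in> S"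
  shows "hproj S v = p"
  unfolding hproj_def
proof (rule the_equality)
  fix q assume q: "q \<in> S \<and> (\<forall>s\<in>S. hinner (v - q) s = 0)"
  \<comment> \<open>Two candidates differ by an element of \<open>S\<close> orthogonal to
    \<open>S\<close>, hence to itself.\<close>
  have "hinner (q - p) (q - p) = hinner (v - p) (q - p) - hinner (v - q) (q - p)"
    using hinner_add_left[of "q - p" "v - q" "q - p"] by simp
  also have "\<dots> = 0"
    using q assms by simp
  finally show "q = p"
    by (simp add: hinner_self)
qed (use assms in blast)

lemma scaleR_half_add_half:
  fixes a b :: "'a::real_vector"
  shows "(1/2) *\<^sub>R a + (1/2) *\<^sub>R a = a"
    and "(1/2) *\<^sub>R a + ((1/2) *\<^sub>R a + b) = a + b"
  by (simp_all flip: scaleR_add_left add.assoc)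

text \<open>The projector is (1 - i J) / 2: the remainder \<open>(d, J d)\<close> lies in the
  conjugate eigenspace, which is orthogonal to this one.\<close>

lemma hproj_skew_graph:
  fixes v :: "'a::euclidean_space cplx"
  assumes J: "ortho_complex J"
  defines "p \<equiv> (1/2) *\<^sub>R (fst v + J (snd v))"
  shows "hproj (skew_graph J) v = (p, - J p)"
proof (rule hproj_eqI)
  note lin = ortho_complex_linear[OF J]
  show "(p, - J p) \<in> skew_graph J"
    by (simp add: skew_graph_def)
  show "s - t \<in> skew_graph J" if "s \<in> skew_graph J" "t \<in> skew_graph J" for s t
    using that by (auto simp: skew_graph_def image_iff linear_diff[OF lin])
  fix s assume "s \<in> skew_graph J"
  then obtain x where s: "s = (x, - J x)"
    by (auto simp: skew_graph_def)
  define d where "d = (1/2) *\<^sub>R (fst v - J (snd v))"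
  have "v - (p, - J p) = (d, J d)"
    by (simp add: prod_eq_iff p_def d_def linear_add[OF lin] linear_diff[OF lin] linear_scale[OF lin]
        ortho_complex_square[OF J] algebra_simps scaleR_half_add_half)
  then show "hinner (v - (p, - J p)) s = 0"
    using ortho_complex_skew[OF J, of d x]
    by (simp add: s hinner_def complex_eq_iff ortho_complex_inner[OF J])
qed

section \<open>Invariant planes of complex structures\<close>

lemma ortho_complex_plane:
  assumes J: "ortho_complex J" and "x \<noteq> 0"
  shows "dim (span {x, J x}) = 2" "J ` span {x, J x} \<subseteq> span {x, J x}"
proof -
  note lin = ortho_complex_linear[OF J]
  have ne: "J x \<noteq> 0"
    using ortho_complex_inner[OF J, of x x] \<open>x \<noteq> 0\<close> by auto
  have orth: "x \<bullet> J x = 0"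
    by (rule ortho_complex_self[OF J])
  then have "x \<noteq> J x"
    using \<open>x \<noteq> 0\<close> by auto
  moreover have "independent {x, J x}"
    by (rule pairwise_orthogonal_independent)
      (use orth ne \<open>x \<noteq> 0\<close> in \<open>auto simp: pairwise_def orthogonal_def inner_commute\<close>)
  ultimately show "dim (span {x, J x}) = 2"
    by (simp add: dim_eq_card_independent)
  have "J ` {x, J x} \<subseteq> span {x, J x}"
    by (auto simp: ortho_complex_square[OF J] span_base span_neg)
  then show "J ` span {x, J x} \<subseteq> span {x, J x}"
    by (metis linear_span_image[OF lin] span_minimal subspace_span)
qed

text \<open>One test vector suffices: \<open>span {x, J x}\<close> already has dimension 2, so it
  fills \<open>W\<close>.\<close>

lemma ortho_complex_plane_invariant:
  assumes J: "ortho_complex J" and W: "subspace W" "dim W = 2"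
    and x: "x \<in> W" "x \<noteq> 0" "J x \<in> W"
  shows "J ` W \<subseteq> W"
proof -
  have "span {x, J x} \<subseteq> W"
    using W x by (intro span_minimal) auto
  then have "span {x, J x} = W"
    using W ortho_complex_plane(1)[OF J x(2)] by (intro subspace_dim_equal) auto
  then show ?thesis
    using ortho_complex_plane(2)[OF J x(2)] by simp
qed

lemma common_plane_imp_agree:
  assumes J: "ortho_complex J" and K: "ortho_complex K"
    and W: "dim W = 2" "subspace W" "J ` W \<subseteq> W" "K ` W \<subseteq> W"
  shows "\<exists>x. x \<noteq> 0 \<and> (J x = K x \<or> J x = - K x)"
proof (rule ccontr)
  assume none: "\<not> ?thesis"
  obtain v where v: "v \<in> W" "v \<noteq> 0"
    using W(1) by (metis dim_eq_0 subsetI singletonI zero_neq_numeral)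
  let ?a = "J v + K v" and ?b = "J v - K v"
  have ne: "?a \<noteq> 0" "?b \<noteq> 0"
    using none v(2) by (auto simp: add_eq_0_iff)
  \<comment> \<open>The last product is |J v|^2 - |K v|^2, which vanishes because both maps are
    isometries.\<close>
  have orth: "v \<bullet> ?a = 0" "v \<bullet> ?b = 0" "?a \<bullet> ?b = 0"
    using ortho_complex_self[OF J, of v] ortho_complex_self[OF K, of v]
      ortho_complex_inner[OF J, of v v] ortho_complex_inner[OF K, of v v]
    by (simp_all add: inner_add_left inner_add_right inner_diff_right inner_commute)
  then have "independent {v, ?a, ?b}"
    using ne v(2)
    by (intro pairwise_orthogonal_independent) (auto simp: pairwise_def orthogonal_def inner_commute)
  moreover have "{v, ?a, ?b} \<subseteq> W"
    using v W by (auto intro!: subspace_add subspace_diff)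
  ultimately have "card {v, ?a, ?b} \<le> 2"
    using independent_card_le_dim W(1) by metis
  \<comment> \<open>Distinctness makes the cardinality 3, against the bound 2.\<close>
  moreover have "v \<noteq> ?a" "v \<noteq> ?b" "?a \<noteq> ?b"
    using orth ne by (metis inner_eq_zero_iff)+
  ultimately show False
    by (simp del: add_left_cancel)
qed

lemma common_plane_if_agree:
  assumes J: "ortho_complex J" and "x \<noteq> 0" "K x = J x \<or> K x = - J x" and K: "ortho_complex K"
  shows "\<exists>W. subspace W \<and> dim W = 2 \<and> J ` W \<subseteq> W \<and> K ` W \<subseteq> W"
proof (intro exI conjI)
  show "K ` span {x, J x} \<subseteq> span {x, J x}"
    using assms ortho_complex_plane(1)[OF J \<open>x \<noteq> 0\<close>]
    by (intro ortho_complex_plane_invariant[OF K, of _ x]) (auto simp: span_base span_neg)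
qed (use ortho_complex_plane[OF J \<open>x \<noteq> 0\<close>] in auto)

section \<open>The antilinear operator T\<close>

lemma T_op_skew_graph:
  assumes J: "ortho_complex J" and K: "ortho_complex K"
    and inj: "\<And>x. J x = - K x \<Longrightarrow> x = 0"
  obtains x where "p = (1/2) *\<^sub>R (x - J (K x))"
    and "fst (T_op (skew_graph J) (skew_graph (\<lambda>v. - J v)) (skew_graph K) (p, - J p))
      = (1/2) *\<^sub>R (x + J (K x))"
proof -
  note lJ = ortho_complex_linear[OF J] and lK = ortho_complex_linear[OF K]
  \<comment> \<open>\<open>?f\<close> is P_A restricted to \<open>C\<close>, read in first
    coordinates.\<close>
  let ?f = "\<lambda>x. (1/2) *\<^sub>R (x - J (K x))"
  let ?P = "hproj (skew_graph J)" and ?C = "skew_graph K"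
  have PC: "?P (x, - K x) = (?f x, - J (?f x))" for x
    by (simp add: hproj_skew_graph[OF J] linear_neg[OF lJ])
  have linf: "linear ?f"
    using linear_compose[OF lK lJ]
    by (intro linear_compose_scale_right linear_compose_sub linear_id[unfolded id_def]) (simp add: o_def)
  have "inj ?f"
    unfolding linear_injective_0[OF linf]
  proof (intro allI impI)
    \<comment> \<open>A kernel vector satisfies x = J K x; applying \<open>J\<close> gives J x = - K
      x.\<close>
    fix x assume "?f x = 0"
    then have "J x = J (J (K x))" by simp
    then show "x = 0"
      using inj by (simp add: ortho_complex_square[OF J])
  qed
  then have "surj ?f"
    by (rule linear_inj_imp_surj[OF linf])
  then obtain y where "p = ?f y"
    by (rule surjE)
  then have "(p, - J p) \<in> ?P ` ?C"
    using PC[of y] by (intro image_eqI[of _ _ "(y, - K y)"]) (auto simp: skew_graph_def)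
  \<comment> \<open>\<open>inv_into\<close> returns a genuine preimage only for points of the image,
    whence the surjectivity of \<open>?f\<close>.\<close>
  then have "inv_into ?C ?P (p, - J p) \<in> ?C" "?P (inv_into ?C ?P (p, - J p)) = (p, - J p)"
    by (auto intro: inv_into_into f_inv_into_f)
  then obtain x where x: "inv_into ?C ?P (p, - J p) = (x, - K x)" "p = ?f x"
    using PC unfolding skew_graph_def by force
  show ?thesis
    by (rule that[of x])
      (use x in \<open>simp_all add: T_op_def cconj_def hproj_skew_graph[OF ortho_complex_uminus[OF J]]
        linear_neg[OF lJ]\<close>)
qed

lemma common_plane_if_T_op_invariant:
  assumes J: "ortho_complex J" and K: "ortho_complex K"
    and inj: "\<And>x. J x = - K x \<Longrightarrow> x = 0"
    and L: "cvs.dim L = 1" "L \<subseteq> skew_graph J"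
    and TL: "T_op (skew_graph J) (skew_graph (\<lambda>v. - J v)) (skew_graph K) ` L \<subseteq> L"
  shows "\<exists>W. subspace W \<and> dim W = 2 \<and> J ` W \<subseteq> W \<and> K ` W \<subseteq> W"
proof -
  note lJ = ortho_complex_linear[OF J] and lK = ortho_complex_linear[OF K]
  obtain b where b: "b \<subseteq> L" "cvs.independent b" "L \<subseteq> cvs.span b" "card b = 1"
    using cvs.basis_exists[of L] L(1) by metis
  then obtain l where l: "b = {l}"
    by (auto simp: card_1_singleton_iff)
  have "l \<noteq> 0"
    using b(2) l cvs.dependent_zero by blast
  obtain p where p: "l = (p, - J p)"
    using b(1) l L(2) by (auto simp: skew_graph_def)
  have "p \<noteq> 0"
    using \<open>l \<noteq> 0\<close> p linear_0[OF lJ] by (auto simp: zero_prod_def)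
  let ?T = "T_op (skew_graph J) (skew_graph (\<lambda>v. - J v)) (skew_graph K)"
  have "?T l \<in> cvs.span {l}"
    using TL b l by auto
  then obtain z where z: "?T l = cscale z l"
    by (auto simp: cvs.span_singleton)
  obtain x where x: "p = (1/2) *\<^sub>R (x - J (K x))" "fst (?T l) = (1/2) *\<^sub>R (x + J (K x))"
    unfolding p using T_op_skew_graph[OF J K inj] by metis
  define q where "q = fst (?T l)"
  let ?W = "span {p, J p}"
  note W = ortho_complex_plane[OF J \<open>p \<noteq> 0\<close>]
  \<comment> \<open>Passing to first coordinates turns the complex line spanned by \<open>l\<close>
    into the real plane \<open>?W\<close>.\<close>
  have "q = Re z *\<^sub>R p + Im z *\<^sub>R J p"
    unfolding q_def z by (simp add: p cscale_def)
  then have pq: "p \<in> ?W" "q \<in> ?W"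
    by (auto simp: span_base span_add span_scale)
  \<comment> \<open>Sum and difference undo the two projections; one more \<open>J\<close> turns
    \<open>J (K x)\<close> into \<open>- K x\<close>, so \<open>x\<close> becomes a test vector for
    \<open>K\<close>.\<close>
  have "p + q = x" "q - p = J (K x)"
    unfolding x(1) x(2)[folded q_def] by (simp_all add: algebra_simps scaleR_half_add_half)
  then have "x \<in> ?W" "J (K x) \<in> ?W"
    using pq span_add span_diff by metis+
  then have "J (J (K x)) \<in> ?W"
    using W(2) by blast
  then have "K x \<in> ?W"
    using span_neg ortho_complex_square[OF J] by fastforce
  moreover have "x \<noteq> 0"
    using x(1) \<open>p \<noteq> 0\<close> by (auto simp: linear_0[OF lJ] linear_0[OF lK])
  ultimately have "K ` ?W \<subseteq> ?W"
    using \<open>x \<in> ?W\<close> W(1) by (intro ortho_complex_plane_invariant[OF K, of _ x]) auto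
  then show ?thesis
    using W by (intro exI[of _ ?W]) auto
qed

section \<open>Transfer to the rotations and the equivalence\<close>

lemma invariant_iff_complex_structure:
  assumes dec: "\<And>v. \<delta> v = a *\<^sub>R v + b *\<^sub>R J v" and "b \<noteq> 0" "subspace W"
  shows "\<delta> ` W \<subseteq> W \<longleftrightarrow> J ` W \<subseteq> W"
proof -
  \<comment> \<open>As b is nonzero, each of \<open>J\<close> and \<delta> is a combination of the
    other and the identity.\<close>
  have "J v = (1 / b) *\<^sub>R (\<delta> v - a *\<^sub>R v)" for v
    using \<open>b \<noteq> 0\<close> by (simp add: dec)
  then have "J v \<in> W" if "v \<in> W" "\<delta> v \<in> W" for v
    using that \<open>subspace W\<close> by (metis subspace_diff subspace_scale)
  moreover have "\<delta> v \<in> W" if "v \<in> W" "J v \<in> W" for v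
    using that \<open>subspace W\<close> by (simp add: dec subspace_add subspace_scale)
  ultimately show ?thesis
    by blast
qed

theorem proposition2p2:
  fixes \<delta> \<epsilon> :: "'a::euclidean_space \<Rightarrow> 'a" and \<alpha> \<beta> :: real
    and A B C D :: "'a cplx set"
  assumes "rotation \<delta>" and "rotation \<epsilon>"
    and "\<alpha> = rotation_angle \<delta>" and "0 < \<alpha>" and "\<alpha> < pi"
    and "\<beta> = rotation_angle \<epsilon>" and "0 < \<beta>" and "\<beta> < pi"
    and "A = eigenspace (cext \<delta>) (exp (\<i> * complex_of_real \<alpha>))"
    and "B = eigenspace (cext \<delta>) (exp (- \<i> * complex_of_real \<alpha>))"
    and "C = eigenspace (cext \<epsilon>) (exp (\<i> * complex_of_real \<beta>))"
    and "D = eigenspace (cext \<epsilon>) (exp (- \<i> * complex_of_real \<beta>))"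
  shows "(\<exists>W :: 'a set. subspace W \<and> dim W = 2 \<and> \<delta> ` W \<subseteq> W \<and> \<epsilon> ` W \<subseteq> W)
    \<longleftrightarrow>
      (A \<inter> C \<noteq> {0} \<or> A \<inter> D \<noteq> {0})
    \<or> (A \<inter> C = {0} \<and> A \<inter> D = {0} \<and>
        (\<exists>L. cvs.subspace L \<and> cvs.dim L = 1 \<and> L \<subseteq> A \<and> T_op A B C ` L \<subseteq> L))"
proof -
  obtain J where J: "ortho_complex J" "\<And>v. \<delta> v = cos \<alpha> *\<^sub>R v + sin \<alpha> *\<^sub>R J v"
    using rotation_decompose assms by metis
  obtain K where K: "ortho_complex K" "\<And>v. \<epsilon> v = cos \<beta> *\<^sub>R v + sin \<beta> *\<^sub>R K v"
    using rotation_decompose assms by metis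
  have s: "sin \<alpha> \<noteq> 0" "sin \<beta> \<noteq> 0"
    using sin_gt_zero assms by (metis less_irrefl)+
  have E: "A = skew_graph J" "B = skew_graph (\<lambda>v. - J v)"
    "C = skew_graph K" "D = skew_graph (\<lambda>v. - K v)"
    using rotation_eigenspaces[OF J s(1)] rotation_eigenspaces[OF K s(2)] assms by simp_all
  note lin = ortho_complex_linear[OF J(1)] ortho_complex_linear[OF K(1)]
    ortho_complex_linear[OF ortho_complex_uminus[OF K(1)]]
  have AC: "A \<inter> C \<noteq> {0} \<longleftrightarrow> (\<exists>x. x \<noteq> 0 \<and> J x = K x)"
    unfolding E by (rule skew_graph_Int_nontrivial[OF lin(1,2)])
  have AD: "A \<inter> D \<noteq> {0} \<longleftrightarrow> (\<exists>x. x \<noteq> 0 \<and> J x = - K x)"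
    unfolding E by (rule skew_graph_Int_nontrivial[OF lin(1,3)])
  let ?inv = "\<exists>W. subspace W \<and> dim W = 2 \<and> J ` W \<subseteq> W \<and> K ` W \<subseteq> W"
  have "(\<exists>W. subspace W \<and> dim W = 2 \<and> \<delta> ` W \<subseteq> W \<and> \<epsilon> ` W \<subseteq> W) \<longleftrightarrow> ?inv"
    using invariant_iff_complex_structure[OF J(2) s(1)]
      invariant_iff_complex_structure[OF K(2) s(2)] by metis
  moreover have "A \<inter> C \<noteq> {0} \<or> A \<inter> D \<noteq> {0}" if inv: ?inv
  proof -
    obtain W where "dim W = 2" "subspace W" "J ` W \<subseteq> W" "K ` W \<subseteq> W"
      using inv by blast
    then show ?thesis
      unfolding AC AD using common_plane_imp_agree[OF J(1) K(1)] by blast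
  qed
  moreover have ?inv if agree: "A \<inter> C \<noteq> {0} \<or> A \<inter> D \<noteq> {0}"
  proof -
    obtain x where "x \<noteq> 0" "J x = K x \<or> J x = - K x"
      using agree AC AD by blast
    then show ?thesis
      by (intro common_plane_if_agree[OF J(1) _ _ K(1), of x]) auto
  qed
  moreover have ?inv if AD0: "A \<inter> D = {0}"
    and ex: "\<exists>L. cvs.subspace L \<and> cvs.dim L = 1 \<and> L \<subseteq> A \<and> T_op A B C ` L \<subseteq> L"
  proof -
    obtain L where "cvs.dim L = 1" "L \<subseteq> A" "T_op A B C ` L \<subseteq> L"
      using ex by blast
    \<comment> \<open>Triviality of the intersection of \<open>A\<close> and \<open>D\<close>
      supplies the injectivity of P_A on \<open>C\<close>.\<close>
    moreover have "x = 0" if "J x = - K x" for x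
      using that AD0 AD by blast
    ultimately show ?thesis
      unfolding E by (intro common_plane_if_T_op_invariant[OF J(1) K(1)])
  qed
  ultimately show ?thesis
    by argo
qed

end
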